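(* Suppose that the branch network's architecture is sufficiently large so that for any $M\in\mathbb{R}^{(N+1)\times K}$ there exists a branch parameter $\tilde\theta$ with $\bm{C}(\tilde\theta)=M$. Let $(\mu^*,A^* )$ be an optimal solution of $$\min_{\mu,\,A\in\mathbb{R}^{(N+1)\times K}}\|\bm{\Phi}(\mu)A-\bm{U}\|_{p,p}^p ,$$ suppose $\bm{\Phi}(\mu^* )$ has full rank, let $Q^*R^*=\bm{\Phi}(\mu^* )$ be a QR-factorization, and set $T^*=(R^* )^{-1}$. Let $\theta^*$ be an optimal solution of $$\min_{\theta}\|\bm{C}(\theta)-R^*A^*\|_{2,2}^2 .$$ Then $$\|\bm{\Phi}(\mu^* )\,T^*\,\bm{C}(\theta^* )-\bm{U}\|_{p,p}^p=\min_{\mu,\theta}\|\bm{\Phi}(\mu)\bm{C}(\theta)-\bm{U}\|_{p,p}^p .$$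
   Context: Setting. $1\le p<\infty$; $\Omega_y\subset\mathbb{R}^{d_y}$ is compact; $N,K,m_x,m_y$ are positive integers with $m_y>N$. Feed-forward networks: for $\vec{\bm n}=(n_0,\dots,n_L)$, an $L$-layer network with activation $\sigma$ (applied entrywise) is the map $\mathbb{R}^{n_0}\ni x\mapsto z^L\in\mathbb{R}^{n_L}$, $z^1=W^1x+b^1$, $z^\ell=W^\ell\sigma(z^{\ell-1})+b^\ell$ for $2\le\ell\le L$, with $W^\ell\in\mathbb{R}^{n_\ell\times n_{\ell-1}}$, $b^\ell\in\mathbb{R}^{n_\ell}$; the parameters are all the $W^\ell,b^\ell$. Branch network: $\bm{c}(\cdot;\theta)=(c_0(\cdot;\theta),\dots,c_N(\cdot;\theta))^\top:\mathbb{R}^{m_x}\to\mathbb{R}^{N+1}$, a feed-forward network of a fixed architecture with parameters $\theta$. Trunk network: $\bm{\phi}(\cdot;\mu)=(1,\bm{\phi}_0(\cdot;\mu))^\top:\Omega_y\to\mathbb{R}^{N+1}$, where $\bm{\phi}_0(\cdot;\mu)=(\phi_1(\cdot;\mu),\dots,\phi_N(\cdot;\mu))$ is a feed-forward network of a fixed architecture with parameters $\mu$. Data: vectors $\bm{f}_1,\dots,\bm{f}_K\in\mathbb{R}^{m_x}$ (discretized input functions), points $y_1,\dots,y_{m_y}\in\Omega_y$, and $\bm{u}_k=(u_k(y_1),\dots,u_k(y_{m_y}))^\top\in\mathbb{R}^{m_y}$ for output functions $u_1,\dots,u_K$ on $\Omega_y$. Put $\bm{U}=[\bm{u}_1,\dots,\bm{u}_K]\in\mathbb{R}^{m_y\times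 K}$, let $\bm{\Phi}(\mu)\in\mathbb{R}^{m_y\times(N+1)}$ be the matrix with $i$-th row $\bm{\phi}^\top(y_i;\mu)$, and $\bm{C}(\theta)=[\bm{c}(\bm{f}_1;\theta),\dots,\bm{c}(\bm{f}_K;\theta)]\in\mathbb{R}^{(N+1)\times K}$. $\|\cdot\|_{p,p}$ is the entrywise matrix norm, $\|B\|_{p,p}^p=\sum_{i,j}|B_{ij}|^p$. The QR-factorization is the reduced one: $Q^*\in\mathbb{R}^{m_y\times(N+1)}$ has orthonormal columns and $R^*\in\mathbb{R}^{(N+1)\times(N+1)}$ is upper triangular and invertible. *)

theory Defs
  imports "HOL-Analysis.Abstract_Euclidean_Space" "Jordan_Normal_Form.DL_Rank"
begin

text \<open>A network parameter is the list of its weight/bias pairs: entry \<open>l\<close> of the list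
  is the pair of the weight and bias of layer \<open>l + 1\<close>. The architecture is the list of
  widths, including that of the input layer.\<close>

type_synonym ffn_param = "(real mat \<times> real vec) list"

definition architecture :: "nat list \<Rightarrow> nat \<Rightarrow> nat \<Rightarrow> bool" where
  "architecture ns n_in n_out \<longleftrightarrow> length ns \<ge> 2 \<and> hd ns = n_in \<and> last ns = n_out"

definition ffn_params :: "nat list \<Rightarrow> ffn_param set" where
  "ffn_params ns = {\<theta>. length \<theta> = length ns - 1 \<and>
     (\<forall>l < length \<theta>. fst (\<theta> ! l) \<in> carrier_mat (ns ! Suc l) (ns ! l) \<and>
                     snd (\<theta> ! l) \<in> carrier_vec (ns ! Suc l))}"

primrec ffn_layer :: "(real \<Rightarrow> real) \<Rightarrow> ffn_param \<Rightarrow> real vec \<Rightarrow> nat \<Rightarrow> real vec" where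
  "ffn_layer \<sigma> \<theta> x 0 = fst (\<theta> ! 0) *\<^sub>v x + snd (\<theta> ! 0)"
| "ffn_layer \<sigma> \<theta> x (Suc l) =
     fst (\<theta> ! Suc l) *\<^sub>v map_vec \<sigma> (ffn_layer \<sigma> \<theta> x l) + snd (\<theta> ! Suc l)"

definition ffn :: "(real \<Rightarrow> real) \<Rightarrow> ffn_param \<Rightarrow> real vec \<Rightarrow> real vec" where
  "ffn \<sigma> \<theta> x = ffn_layer \<sigma> \<theta> x (length \<theta> - 1)"

text \<open>Points of the output domain live in \<^term>\<open>Euclidean_space d\<close>, whose elements are the
  functions \<open>nat \<Rightarrow> real\<close> supported on \<open>{..<d}\<close>; they are turned into vectors by
  \<^term>\<open>vec d\<close> before being fed to the network.\<close>

definition trunk :: "(real \<Rightarrow> real) \<Rightarrow> nat \<Rightarrow> ffn_param \<Rightarrow> (nat \<Rightarrow> real) \<Rightarrow> real vec" where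
  "trunk \<sigma> d \<mu> y = vCons 1 (ffn \<sigma> \<mu> (vec d y))"

definition trunk_mat ::
  "(real \<Rightarrow> real) \<Rightarrow> nat \<Rightarrow> nat \<Rightarrow> nat \<Rightarrow> (nat \<Rightarrow> nat \<Rightarrow> real) \<Rightarrow> ffn_param \<Rightarrow> real mat" where
  "trunk_mat \<sigma> d N m y \<mu> = mat_of_rows (N + 1) (map (\<lambda>i. trunk \<sigma> d \<mu> (y i)) [0..<m])"

definition branch_mat ::
  "(real \<Rightarrow> real) \<Rightarrow> nat \<Rightarrow> nat \<Rightarrow> (nat \<Rightarrow> real vec) \<Rightarrow> ffn_param \<Rightarrow> real mat" where
  "branch_mat \<sigma> N K f \<theta> = mat_of_cols (N + 1) (map (\<lambda>k. ffn \<sigma> \<theta> (f k)) [0..<K])"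

definition data_mat ::
  "nat \<Rightarrow> nat \<Rightarrow> (nat \<Rightarrow> nat \<Rightarrow> real) \<Rightarrow> (nat \<Rightarrow> (nat \<Rightarrow> real) \<Rightarrow> real) \<Rightarrow> real mat" where
  "data_mat m K y u = mat_of_cols m (map (\<lambda>k. vec m (\<lambda>i. u k (y i))) [0..<K])"

definition entry_norm :: "real \<Rightarrow> real mat \<Rightarrow> real" where
  "entry_norm p B =
     (\<Sum>i<dim_row B. \<Sum>j<dim_col B. \<bar>B $$ (i, j)\<bar> powr p) powr (1 / p)"

lemma entry_norm_powr:
  assumes "p > 0"
  shows "entry_norm p B powr p = (\<Sum>i<dim_row B. \<Sum>j<dim_col B. \<bar>B $$ (i, j)\<bar> powr p)"
  using assms by (simp add: entry_norm_def powr_powr sum_nonneg)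

definition reduced_QR :: "nat \<Rightarrow> nat \<Rightarrow> real mat \<Rightarrow> real mat \<Rightarrow> real mat \<Rightarrow> bool" where
  "reduced_QR m n A Q R \<longleftrightarrow>
     Q \<in> carrier_mat m n \<and> R \<in> carrier_mat n n \<and>
     (\<forall>i<n. \<forall>j<n. col Q i \<bullet> col Q j = (if i = j then 1 else 0)) \<and>
     upper_triangular R \<and> invertible_mat R \<and> Q * R = A"

end

theory Submission
  imports Defs
begin

text \<open>Since the branch network attains every matrix, the second minimisation has value \<open>0\<close> and
  \<open>C(\<theta>\<^sup>*) = R\<^sup>*A\<^sup>*\<close>. The factor \<open>T\<^sup>*\<close> cancels \<open>R\<^sup>*\<close>, so the left-hand side is the optimal value
  of the unconstrained problem in \<open>(\<mu>, A)\<close>. It bounds \<open>\<parallel>\<Phi>(\<mu>)C(\<theta>) - U\<parallel>\<close> from below because \<open>C(\<theta>)\<close> is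
  an admissible \<open>A\<close>, and it is attained because \<open>A\<^sup>*\<close> is of the form \<open>C(\<theta>)\<close>.\<close>

text \<open>\<open>mat_of_rows\<close> fixes the width \<open>N + 1\<close> whatever the lengths of
  its rows, so the dimensions are known for every \<open>\<mu>\<close>.\<close>

lemma trunk_mat_carrier [simp]: "trunk_mat \<sigma> d N m y \<mu> \<in> carrier_mat m (N + 1)"
  unfolding trunk_mat_def by (rule carrier_matI) simp_all

lemma branch_mat_carrier [simp]: "branch_mat \<sigma> N K f \<theta> \<in> carrier_mat (N + 1) K"
  unfolding branch_mat_def by (rule carrier_matI) simp_all

lemma entry_norm_eq_0_iff:
  assumes "p > 0" and "B \<in> carrier_mat m n"
  shows "entry_norm p B = 0 \<longleftrightarrow> B = 0\<^sub>m m n"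
proof -
  \<comment> \<open>Passing to the \<open>p\<close>-th power undoes the outer root, leaving a sum of
    nonnegative terms that vanishes only termwise.\<close>
  have "entry_norm p B = 0 \<longleftrightarrow> entry_norm p B powr p = 0"
    by simp
  also have "\<dots> \<longleftrightarrow> (\<forall>i\<in>{..<m}. (\<Sum>j<n. \<bar>B $$ (i, j)\<bar> powr p) = 0)"
    using assms by (simp only: entry_norm_powr carrier_matD)
      (rule sum_nonneg_eq_0_iff, simp_all add: sum_nonneg)
  also have "\<dots> \<longleftrightarrow> (\<forall>i<m. \<forall>j<n. B $$ (i, j) = 0)"
    by (simp add: sum_nonneg_eq_0_iff Ball_def)
  also have "\<dots> \<longleftrightarrow> B = 0\<^sub>m m n"
    using assms(2) by (simp add: mat_eq_iff)
  finally show ?thesis .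
qed

text \<open>An admissible exact fit makes the objective \<open>0\<close>, its least conceivable
  value; a minimiser must then have value \<open>0\<close> too, and definiteness of the entrywise
  norm forces equality.\<close>

lemma is_arg_min_entry_norm_attained:
  assumes min: "is_arg_min (\<lambda>\<theta>. entry_norm p (C \<theta> - M) powr p) P \<theta>opt"
    and "p > 0" and "C \<theta>opt \<in> carrier_mat m n" and "M \<in> carrier_mat m n"
    and "P \<theta>" and "C \<theta> = M"
  shows "C \<theta>opt = M"
proof -
  have "entry_norm p (C \<theta> - M) powr p = 0"
    using assms(2,4,6) by (simp add: entry_norm_eq_0_iff[of p _ m n])
  moreover have "entry_norm p (C \<theta>opt - M) powr p \<le> entry_norm p (C \<theta> - M) powr p"
    using min \<open>P \<theta>\<close> by (auto simp: is_arg_min_linorder)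
  ultimately have "entry_norm p (C \<theta>opt - M) powr p = 0"
    using powr_ge_zero[of "entry_norm p (C \<theta>opt - M)" p] by linarith
  then have zero: "C \<theta>opt - M = 0\<^sub>m m n"
    using assms(2-4) by (simp add: entry_norm_eq_0_iff[of p _ m n] minus_carrier_mat)
  show ?thesis
  proof (rule eq_matI)
    fix i j assume "i < dim_row M" "j < dim_col M"
    then show "C \<theta>opt $$ (i, j) = M $$ (i, j)"
      using arg_cong[OF zero, of "\<lambda>B. B $$ (i, j)"] assms(3,4) by simp
  qed (use assms(3,4) in auto)
qed

theorem theorem3p4:
  fixes p :: real and N K mx my dy :: nat
    and \<Omega> :: "(nat \<Rightarrow> real) set"
    and \<sigma>b \<sigma>t :: "real \<Rightarrow> real"
    and nb nt :: "nat list"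
    and f :: "nat \<Rightarrow> real vec"
    and y :: "nat \<Rightarrow> nat \<Rightarrow> real"
    and u :: "nat \<Rightarrow> (nat \<Rightarrow> real) \<Rightarrow> real"
    and \<Phi> C :: "ffn_param \<Rightarrow> real mat"
    and U Aopt Q R T :: "real mat"
    and \<mu>opt \<theta>opt :: ffn_param
  defines "\<Phi> \<equiv> trunk_mat \<sigma>t dy N my y"
    and "C \<equiv> branch_mat \<sigma>b N K f"
    and "U \<equiv> data_mat my K y u"
  assumes "1 \<le> p"
    and "N > 0" "K > 0" "mx > 0" "my > N"
    and "compactin (Euclidean_space dy) \<Omega>"
    and "architecture nb mx (N + 1)"
    and "architecture nt dy N"
    and "\<And>k. k < K \<Longrightarrow> f k \<in> carrier_vec mx"
    and "\<And>i. i < my \<Longrightarrow> y i \<in> \<Omega>"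
    and branch_rich: "\<forall>M \<in> carrier_mat (N + 1) K. \<exists>\<theta> \<in> ffn_params nb. C \<theta> = M"
    and trunk_opt: "is_arg_min (\<lambda>(\<mu>, A). entry_norm p (\<Phi> \<mu> * A - U) powr p)
           (\<lambda>(\<mu>, A). \<mu> \<in> ffn_params nt \<and> A \<in> carrier_mat (N + 1) K) (\<mu>opt, Aopt)"
    and full_rank: "vec_space.rank my (\<Phi> \<mu>opt) = min my (N + 1)"
    and QR: "reduced_QR my (N + 1) (\<Phi> \<mu>opt) Q R"
    and T: "T \<in> carrier_mat (N + 1) (N + 1)" "inverts_mat R T" "inverts_mat T R"
    and branch_opt: "is_arg_min (\<lambda>\<theta>. entry_norm 2 (C \<theta> - R * Aopt) powr 2)
           (\<lambda>\<theta>. \<theta> \<in> ffn_params nb) \<theta>opt"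
  shows "\<exists>\<mu> \<theta>. is_arg_min (\<lambda>(\<mu>, \<theta>). entry_norm p (\<Phi> \<mu> * C \<theta> - U) powr p)
                 (\<lambda>(\<mu>, \<theta>). \<mu> \<in> ffn_params nt \<and> \<theta> \<in> ffn_params nb) (\<mu>, \<theta>) \<and>
           entry_norm p (\<Phi> \<mu>opt * T * C \<theta>opt - U) powr p =
           entry_norm p (\<Phi> \<mu> * C \<theta> - U) powr p"
proof -
  have \<Phi>: "\<Phi> \<mu> \<in> carrier_mat my (N + 1)" for \<mu>
    unfolding \<Phi>_def by (rule trunk_mat_carrier)
  have C: "C \<theta> \<in> carrier_mat (N + 1) K" for \<theta>
    unfolding C_def by (rule branch_mat_carrier)
  have A: "Aopt \<in> carrier_mat (N + 1) K" and \<mu>: "\<mu>opt \<in> ffn_params nt"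
    using trunk_opt by (auto simp: is_arg_min_def)
  have R: "R \<in> carrier_mat (N + 1) (N + 1)"
    using QR by (simp add: reduced_QR_def)
  have RA: "R * Aopt \<in> carrier_mat (N + 1) K"
    using R A by (rule mult_carrier_mat)
  obtain \<theta>' where "\<theta>' \<in> ffn_params nb" "C \<theta>' = R * Aopt"
    using branch_rich RA by blast
  then have C_opt: "C \<theta>opt = R * Aopt"
    using is_arg_min_entry_norm_attained[OF branch_opt _ C RA] by simp
  \<comment> \<open>This \<open>\<theta>\<close> is the branch half of the minimising pair. It need
    not be \<open>\<theta>opt\<close>, since \<open>C \<theta>opt\<close> carries the extra factor
    \<open>R\<close>.\<close>
  obtain \<theta> where \<theta>: "\<theta> \<in> ffn_params nb" "C \<theta> = Aopt"
    using branch_rich A by blast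
  \<comment> \<open>The cancellation uses \<open>T\<close> as a left inverse of \<open>R\<close>,
    that is \<open>inverts_mat T R\<close>.\<close>
  have "T * C \<theta>opt = T * R * Aopt"
    using T(1) R A by (simp add: C_opt assoc_mult_mat[of _ "N + 1" "N + 1" _ "N + 1" _ K])
  also have "\<dots> = Aopt"
    using T A by (simp add: inverts_mat_def)
  finally have "\<Phi> \<mu>opt * T * C \<theta>opt = \<Phi> \<mu>opt * C \<theta>"
    using \<Phi> T(1) C \<theta>(2) by (simp add: assoc_mult_mat[of _ my "N + 1" _ "N + 1" _ K])
  \<comment> \<open>Any competitor \<open>(\<mu>, \<theta>)\<close> gives the admissible pair
    \<open>(\<mu>, C \<theta>)\<close> of the trunk problem, so its value is at least that of
    \<open>(\<mu>opt, Aopt)\<close>.\<close>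
  moreover have "is_arg_min (\<lambda>(\<mu>, \<theta>). entry_norm p (\<Phi> \<mu> * C \<theta> - U) powr p)
      (\<lambda>(\<mu>, \<theta>). \<mu> \<in> ffn_params nt \<and> \<theta> \<in> ffn_params nb) (\<mu>opt, \<theta>)"
    using trunk_opt \<mu> \<theta> C by (auto simp: is_arg_min_linorder)
  ultimately show ?thesis
    by auto
qed

end
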